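(* Let $V$ be a valuation domain with maximal ideal $M$ and quotient field $K$, and let $E=\{s_n\}_{n\in\mathbb{N}}\subset K$ be a pseudo-convergent sequence. Then $$V_E=\{\phi\in K(X)\mid \phi(s_n)\in V\text{ for all but finitely many }n\in\mathbb{N}\}$$ is a valuation domain of $K(X)$ lying over $V$ (i.e. $V_E\cap K=V$), with maximal ideal equal to $$M_{V_E}=\{\phi\in K(X)\mid \phi(s_n)\in M\text{ for all but finitely many }n\in\mathbb{N}\}.$$ Moreover, $X$ is a pseudo-limit of $E$ with respect to the valuation $v_E$ on $K(X)$ associated to $V_E$.
   Context: $V$ is a valuation domain of arbitrary rank with valuation $v$. A sequence $E=\{s_n\}_{n\in\mathbb{N}}$ in $K$ is pseudo-convergent if $v(s_{n+1}-s_n)<v(s_{n+2}-s_{n+1})$ for all $n\in\mathbb{N}$. If $w$ is an extension of $v$ to a field $L\supseteq K$, an element $\alpha\in L$ is a pseudo-limit of $E$ with respect to $w$ if $w(\alpha-s_n)<w(\alpha-s_{n+1})$ for all $n\in\mathbb{N}$. Note that, for $\phi\in K(X)$, $\phi(s_n)$ is defined for all but finitely many $n$. *)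

theory Defs
  imports
    "HOL-Computational_Algebra.Computational_Algebra"
    "HOL-Algebra.Algebraic_Closure_Type"
begin

section \<open>Valuation domains\<close>

text \<open>
  The fields \<open>K\<close> and \<open>K(X)\<close> are the types \<open>'a\<close> and \<open>'a poly fract\<close>; subrings and ideals are those
  of HOL-Algebra, applied to \<^const>\<open>ring_of_type_algebra\<close>.
\<close>

abbreviation subring_of :: "'a::field set \<Rightarrow> 'a ring" where
  "subring_of V \<equiv> ring_of_type_algebra\<lparr>carrier := V\<rparr>"

text \<open>
  A valuation domain \<open>V\<close> of the field \<open>'a\<close>. The second condition forces the quotient field of \<open>V\<close>
  to be all of \<open>'a\<close>.
\<close>

definition valuation_domain :: "'a::field set \<Rightarrow> bool" where
  "valuation_domain V \<longleftrightarrow>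
     subring V (ring_of_type_algebra :: 'a ring) \<and> (\<forall>x. x \<noteq> 0 \<longrightarrow> x \<in> V \<or> inverse x \<in> V)"


section \<open>Valuations of arbitrary rank\<close>

text \<open>
  Value groups are totally ordered abelian groups with a carrier, written multiplicatively because
  they extend the monoids of HOL-Algebra. (With a type class instead, the value group
  of a given valuation domain, which depends on that domain, could not be formed.)
\<close>

record 'g ordered_monoid = "'g monoid" +
  vle :: "'g \<Rightarrow> 'g \<Rightarrow> bool" (infixl \<open>\<preceq>\<index>\<close> 50)

locale ordered_abelian_group = comm_group G for G :: "'g ordered_monoid" (structure) +
  assumes vle_antisym: "x \<in> carrier G \<Longrightarrow> y \<in> carrier G \<Longrightarrow> x \<preceq> y \<Longrightarrow> y \<preceq> x \<Longrightarrow> x = y"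
    and vle_trans:
      "x \<in> carrier G \<Longrightarrow> y \<in> carrier G \<Longrightarrow> z \<in> carrier G \<Longrightarrow> x \<preceq> y \<Longrightarrow> y \<preceq> z \<Longrightarrow> x \<preceq> z"
    and vle_total: "x \<in> carrier G \<Longrightarrow> y \<in> carrier G \<Longrightarrow> x \<preceq> y \<or> y \<preceq> x"
    and vle_mult:
      "x \<in> carrier G \<Longrightarrow> y \<in> carrier G \<Longrightarrow> z \<in> carrier G \<Longrightarrow> x \<preceq> y \<Longrightarrow> x \<otimes> z \<preceq> y \<otimes> z"

text \<open>Values live in \<open>G \<union> {\<infinity>}\<close>, with \<^const>\<open>None\<close> as the top element \<open>\<infinity>\<close>.\<close>

definition val_le :: "'g ordered_monoid \<Rightarrow> 'g option \<Rightarrow> 'g option \<Rightarrow> bool" where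
  "val_le G a b = (case b of None \<Rightarrow> True | Some y \<Rightarrow>
                    (case a of None \<Rightarrow> False | Some x \<Rightarrow> x \<preceq>\<^bsub>G\<^esub> y))"

definition val_less :: "'g ordered_monoid \<Rightarrow> 'g option \<Rightarrow> 'g option \<Rightarrow> bool" where
  "val_less G a b \<longleftrightarrow> val_le G a b \<and> a \<noteq> b"

text \<open>The last axiom says \<open>v (x + y) \<ge> min (v x) (v y)\<close>.\<close>

locale valuation = ordered_abelian_group G
  for G :: "'g ordered_monoid" (structure) and v :: "'a::field \<Rightarrow> 'g option" +
  assumes v_infinite_iff: "v x = None \<longleftrightarrow> x = 0"
    and v_closed: "v x = Some g \<Longrightarrow> g \<in> carrier G"
    and v_mult: "v x = Some g \<Longrightarrow> v y = Some h \<Longrightarrow> v (x * y) = Some (g \<otimes> h)"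
    and v_add: "val_le G (v x) (v y) \<Longrightarrow> val_le G (v x) (v (x + y))"

definition valuation_ring :: "'g ordered_monoid \<Rightarrow> ('a::field \<Rightarrow> 'g option) \<Rightarrow> 'a set" where
  "valuation_ring G v = {x. val_le G (Some \<one>\<^bsub>G\<^esub>) (v x)}"


section \<open>The valuation associated to a valuation domain\<close>

text \<open>
  The value group is \<open>K\<^sup>* / V\<^sup>*\<close>, ordered by \<open>x V\<^sup>* \<preceq> y V\<^sup>*\<close> iff \<open>y / x \<in> V\<close>, and a nonzero \<open>x\<close> has
  the value \<open>x V\<^sup>*\<close>.
\<close>

definition value_group :: "'a::field set \<Rightarrow> 'a set ordered_monoid" where
  "value_group V =
     (let Q = units_of ring_of_type_algebra Mod Units (subring_of V) in
      \<lparr>carrier = carrier Q, monoid.mult = monoid.mult Q, one = one Q,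
       vle = (\<lambda>A B. \<exists>x\<in>A. \<exists>y\<in>B. y / x \<in> V)\<rparr>)"

definition assoc_valuation :: "'a::field set \<Rightarrow> 'a \<Rightarrow> 'a set option" where
  "assoc_valuation V x =
     (if x = 0 then None
      else Some (Units (subring_of V) #>\<^bsub>units_of ring_of_type_algebra\<^esub> x))"


section \<open>Pseudo-convergent sequences and pseudo-limits\<close>

definition pseudo_convergent ::
  "'g ordered_monoid \<Rightarrow> ('a::field \<Rightarrow> 'g option) \<Rightarrow> (nat \<Rightarrow> 'a) \<Rightarrow> bool" where
  "pseudo_convergent G v s \<longleftrightarrow>
     (\<forall>n. val_less G (v (s (n + 1) - s n)) (v (s (n + 2) - s (n + 1))))"

definition pseudo_limit ::
  "'g ordered_monoid \<Rightarrow> ('a::field \<Rightarrow> 'g option) \<Rightarrow> (nat \<Rightarrow> 'a) \<Rightarrow> 'a \<Rightarrow> bool" where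
  "pseudo_limit G w s \<alpha> \<longleftrightarrow> (\<forall>n. val_less G (w (\<alpha> - s n)) (w (\<alpha> - s (n + 1))))"


section \<open>Values of rational functions\<close>

definition rf_const :: "'a::field \<Rightarrow> 'a poly fract" where
  "rf_const c = to_fract [:c:]"

definition rf_X :: "'a::field poly fract" where
  "rf_X = to_fract [:0, 1:]"

definition rf_defined_at :: "'a::field poly fract \<Rightarrow> 'a \<Rightarrow> bool" where
  "rf_defined_at \<phi> a \<longleftrightarrow> (\<exists>p q. \<phi> = Fract p q \<and> poly q a \<noteq> 0)"

definition rf_eval :: "'a::field poly fract \<Rightarrow> 'a \<Rightarrow> 'a" where
  "rf_eval \<phi> a = (THE b. \<exists>p q. \<phi> = Fract p q \<and> poly q a \<noteq> 0 \<and> b = poly p a / poly q a)"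

definition eventually_in :: "(nat \<Rightarrow> 'a::field) \<Rightarrow> 'a set \<Rightarrow> 'a poly fract set" where
  "eventually_in s A = {\<phi>. \<forall>\<^sub>\<infinity>n. rf_defined_at \<phi> (s n) \<and> rf_eval \<phi> (s n) \<in> A}"

lemma rf_eval_Fract:
  fixes p q :: "'a::field poly"
  assumes "poly q a \<noteq> 0"
  shows "rf_eval (Fract p q) a = poly p a / poly q a"
  unfolding rf_eval_def
proof (rule the_equality)
  show "\<exists>p' q'. Fract p q = Fract p' q' \<and> poly q' a \<noteq> 0 \<and>
          poly p a / poly q a = poly p' a / poly q' a"
    using assms by blast
next
  fix b assume "\<exists>p' q'. Fract p q = Fract p' q' \<and> poly q' a \<noteq> 0 \<and> b = poly p' a / poly q' a"
  then obtain p' q' where *: "Fract p q = Fract p' q'" "poly q' a \<noteq> 0" "b = poly p' a / poly q' a"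
    by blast
  have "q \<noteq> 0" "q' \<noteq> 0" using assms * by auto
  then have "p * q' = p' * q" using *(1) by (simp add: eq_fract)
  then have "poly p a * poly q' a = poly p' a * poly q a" by (metis poly_mult)
  then show "b = poly p a / poly q a" using assms *(2,3) frac_eq_eq by metis
qed


section \<open>The associated valuation is a valuation\<close>

context
  fixes V :: "'a::field set"
  assumes V: "valuation_domain V"
begin

interpretation R: Ring.field "ring_of_type_algebra :: 'a ring" by (rule field_from_type_algebra)

private abbreviation "KU \<equiv> units_of (ring_of_type_algebra :: 'a ring)"
private abbreviation "U \<equiv> Units (subring_of V)"

private lemma R_simps [simp]:
  "carrier (ring_of_type_algebra :: 'a ring) = UNIV"
  "x \<otimes>\<^bsub>ring_of_type_algebra :: 'a ring\<^esub> y = x * y"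
  "\<one>\<^bsub>ring_of_type_algebra :: 'a ring\<^esub> = 1"
  "x \<oplus>\<^bsub>ring_of_type_algebra :: 'a ring\<^esub> y = x + y"
  "\<zero>\<^bsub>ring_of_type_algebra :: 'a ring\<^esub> = 0"
  by (simp_all add: ring_of_type_algebra_def)

private lemma V_closed:
  "1 \<in> V" "0 \<in> V" "x \<in> V \<Longrightarrow> y \<in> V \<Longrightarrow> x * y \<in> V" "x \<in> V \<Longrightarrow> y \<in> V \<Longrightarrow> x + y \<in> V"
proof -
  have S: "subring V (ring_of_type_algebra :: 'a ring)"
    using V unfolding valuation_domain_def by blast
  note * = subringE[OF S, unfolded R_simps]
  show "1 \<in> V" "0 \<in> V" by (rule *)+
  show "x \<in> V \<Longrightarrow> y \<in> V \<Longrightarrow> x * y \<in> V" by (rule *)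
  show "x \<in> V \<Longrightarrow> y \<in> V \<Longrightarrow> x + y \<in> V" by (rule *)
qed

private lemma V_total: "x \<noteq> 0 \<Longrightarrow> x \<in> V \<or> inverse x \<in> V"
  using V unfolding valuation_domain_def by blast

private lemma KU_simps:
  "carrier KU = UNIV - {0}" "x \<otimes>\<^bsub>KU\<^esub> y = x * y" "\<one>\<^bsub>KU\<^esub> = 1"
  using R.field_Units by (simp_all add: units_of_def)

private lemma U_eq: "U = {x. x \<in> V \<and> x \<noteq> 0 \<and> inverse x \<in> V}"
proof -
  have "x \<in> U \<longleftrightarrow> x \<in> V \<and> x \<noteq> 0 \<and> inverse x \<in> V" for x
  proof
    assume "x \<in> U"
    then obtain y where "x \<in> V" "y \<in> V" "x * y = 1" by (auto simp: Units_def)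
    then show "x \<in> V \<and> x \<noteq> 0 \<and> inverse x \<in> V"
      by (metis inverse_unique mult_zero_left zero_neq_one)
  next
    assume "x \<in> V \<and> x \<noteq> 0 \<and> inverse x \<in> V"
    then show "x \<in> U" by (auto simp: Units_def intro!: bexI[of _ "inverse x"])
  qed
  then show ?thesis by blast
qed

private lemma KU_group: "comm_group KU" by (rule R.units_comm_group)

private lemma coset_eq: "U #>\<^bsub>KU\<^esub> x = {u * x | u. u \<in> U}"
  by (auto simp: r_coset_def KU_simps)

private lemma U_normal: "U \<lhd> KU"
proof -
  interpret KU: comm_group KU by (rule KU_group)
  have "subgroup U KU"
  proof (rule KU.subgroupI)
    show "U \<subseteq> carrier KU" by (auto simp: KU_simps U_eq)
    show "U \<noteq> {}" using V_closed by (auto simp: U_eq intro!: exI[of _ 1])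
    fix a assume a: "a \<in> U"
    then have "inv\<^bsub>KU\<^esub> a = inverse a"
      by (intro KU.inv_equality) (auto simp: KU_simps U_eq)
    then show "inv\<^bsub>KU\<^esub> a \<in> U" using a by (auto simp: U_eq)
    fix b assume b: "b \<in> U"
    show "a \<otimes>\<^bsub>KU\<^esub> b \<in> U" using a b V_closed by (auto simp: KU_simps U_eq)
  qed
  then show ?thesis by (rule KU.subgroup_imp_normal)
qed

private lemma vg_carrier: "carrier (value_group V) = {U #>\<^bsub>KU\<^esub> x | x. x \<noteq> 0}"
  by (auto simp: value_group_def FactGroup_def RCOSETS_def KU_simps Let_def)

private lemma vg_mem: "x \<noteq> 0 \<Longrightarrow> U #>\<^bsub>KU\<^esub> x \<in> carrier (value_group V)"
  unfolding vg_carrier by (rule CollectI, rule exI[of _ x], simp)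

private lemma vg_mult:
  assumes "x \<noteq> 0" "y \<noteq> 0"
  shows "(U #>\<^bsub>KU\<^esub> x) \<otimes>\<^bsub>value_group V\<^esub> (U #>\<^bsub>KU\<^esub> y) = U #>\<^bsub>KU\<^esub> (x * y)"
  using normal.rcos_sum[OF U_normal, of x y] assms
  by (simp add: value_group_def FactGroup_def KU_simps Let_def)

private lemma vg_one: "\<one>\<^bsub>value_group V\<^esub> = U #>\<^bsub>KU\<^esub> 1"
  by (auto simp: value_group_def FactGroup_def Let_def coset_eq)

private lemma vg_le:
  assumes "x \<noteq> 0" "y \<noteq> 0"
  shows "(U #>\<^bsub>KU\<^esub> x) \<preceq>\<^bsub>value_group V\<^esub> (U #>\<^bsub>KU\<^esub> y) \<longleftrightarrow> y / x \<in> V"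
proof
  assume "(U #>\<^bsub>KU\<^esub> x) \<preceq>\<^bsub>value_group V\<^esub> (U #>\<^bsub>KU\<^esub> y)"
  then obtain u w where uw: "u \<in> U" "w \<in> U" "(w * y) / (u * x) \<in> V"
    by (auto simp: value_group_def Let_def coset_eq)
  have "y / x = inverse w * (u * ((w * y) / (u * x)))"
    using uw assms by (auto simp: U_eq field_simps)
  also have "\<dots> \<in> V" using uw by (intro V_closed) (auto simp: U_eq)
  finally show "y / x \<in> V" .
next
  assume "y / x \<in> V"
  moreover have "1 \<in> U" using V_closed by (auto simp: U_eq)
  ultimately show "(U #>\<^bsub>KU\<^esub> x) \<preceq>\<^bsub>value_group V\<^esub> (U #>\<^bsub>KU\<^esub> y)"
    unfolding value_group_def Let_def coset_eq by simp (metis mult_1)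
qed

private lemma coset_eqI:
  assumes "x \<noteq> 0" "y \<noteq> 0" "y / x \<in> V" "x / y \<in> V"
  shows "U #>\<^bsub>KU\<^esub> x = U #>\<^bsub>KU\<^esub> y"
proof -
  have U: "y / x \<in> U" "x / y \<in> U" using assms by (auto simp: U_eq)
  have UU: "a * b \<in> U" if "a \<in> U" "b \<in> U" for a b using that V_closed by (auto simp: U_eq)
  have 1: "u * x = (u * (x / y)) * y" for u using assms by simp
  have 2: "u * y = (u * (y / x)) * x" for u using assms by simp
  show ?thesis unfolding coset_eq using 1 2 UU U by blast
qed

private lemma vg_group: "comm_group (value_group V)"
proof (rule comm_groupI)
  fix A B C
  show "\<one>\<^bsub>value_group V\<^esub> \<in> carrier (value_group V)"
    unfolding vg_one by (rule vg_mem) simp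
  assume "A \<in> carrier (value_group V)"
  then obtain x where x: "x \<noteq> 0" "A = U #>\<^bsub>KU\<^esub> x" by (auto simp: vg_carrier)
  show "\<one>\<^bsub>value_group V\<^esub> \<otimes>\<^bsub>value_group V\<^esub> A = A" using x by (simp add: vg_one vg_mult)
  show "\<exists>B\<in>carrier (value_group V). B \<otimes>\<^bsub>value_group V\<^esub> A = \<one>\<^bsub>value_group V\<^esub>"
  proof (rule bexI)
    show "(U #>\<^bsub>KU\<^esub> inverse x) \<otimes>\<^bsub>value_group V\<^esub> A = \<one>\<^bsub>value_group V\<^esub>"
      using x by (simp add: vg_one vg_mult)
    show "U #>\<^bsub>KU\<^esub> inverse x \<in> carrier (value_group V)"
      using x by (intro vg_mem) simp
  qed
  assume "B \<in> carrier (value_group V)"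
  then obtain y where y: "y \<noteq> 0" "B = U #>\<^bsub>KU\<^esub> y" by (auto simp: vg_carrier)
  show "A \<otimes>\<^bsub>value_group V\<^esub> B \<in> carrier (value_group V)"
    using x y by (simp add: vg_mult vg_mem)
  show "A \<otimes>\<^bsub>value_group V\<^esub> B = B \<otimes>\<^bsub>value_group V\<^esub> A"
    using x y by (simp add: vg_mult mult.commute)
  assume "C \<in> carrier (value_group V)"
  then obtain z where z: "z \<noteq> 0" "C = U #>\<^bsub>KU\<^esub> z" by (auto simp: vg_carrier)
  show "(A \<otimes>\<^bsub>value_group V\<^esub> B) \<otimes>\<^bsub>value_group V\<^esub> C = A \<otimes>\<^bsub>value_group V\<^esub> (B \<otimes>\<^bsub>value_group V\<^esub> C)"
    using x y z by (simp add: vg_mult mult.assoc)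
qed

private lemma vg_ordered: "ordered_abelian_group (value_group V)"
proof (intro ordered_abelian_group.intro vg_group ordered_abelian_group_axioms.intro)
  fix A B C
  assume "A \<in> carrier (value_group V)" "B \<in> carrier (value_group V)"
  then obtain x y where x: "x \<noteq> 0" "A = U #>\<^bsub>KU\<^esub> x" and y: "y \<noteq> 0" "B = U #>\<^bsub>KU\<^esub> y"
    unfolding vg_carrier by blast
  show "A \<preceq>\<^bsub>value_group V\<^esub> B \<Longrightarrow> B \<preceq>\<^bsub>value_group V\<^esub> A \<Longrightarrow> A = B"
    using x y coset_eqI[of x y] vg_le[of x y] vg_le[of y x] by metis
  show "A \<preceq>\<^bsub>value_group V\<^esub> B \<or> B \<preceq>\<^bsub>value_group V\<^esub> A"
    using x y V_total[of "y / x"] by (simp add: vg_le)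
  assume "C \<in> carrier (value_group V)"
  then obtain z where z: "z \<noteq> 0" "C = U #>\<^bsub>KU\<^esub> z" by (auto simp: vg_carrier)
  show "A \<preceq>\<^bsub>value_group V\<^esub> C" if "A \<preceq>\<^bsub>value_group V\<^esub> B" "B \<preceq>\<^bsub>value_group V\<^esub> C"
  proof -
    have "y / x \<in> V" "z / y \<in> V" using that x y z by (simp_all add: vg_le)
    then have "(z / y) * (y / x) \<in> V" by (intro V_closed)
    then show ?thesis using x y z by (simp add: vg_le)
  qed
  show "A \<preceq>\<^bsub>value_group V\<^esub> B \<Longrightarrow>
      A \<otimes>\<^bsub>value_group V\<^esub> C \<preceq>\<^bsub>value_group V\<^esub> B \<otimes>\<^bsub>value_group V\<^esub> C"
    using x y z by (simp add: vg_le vg_mult)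
qed

lemma valuation_assoc_valuation: "valuation (value_group V) (assoc_valuation V)"
proof (intro valuation.intro vg_ordered valuation_axioms.intro)
  fix x y :: 'a and g h
  show "assoc_valuation V x = None \<longleftrightarrow> x = 0" by (simp add: assoc_valuation_def)
  show "assoc_valuation V x = Some g \<Longrightarrow> g \<in> carrier (value_group V)"
    by (auto simp: assoc_valuation_def vg_carrier split: if_splits)
  show "assoc_valuation V x = Some g \<Longrightarrow> assoc_valuation V y = Some h \<Longrightarrow>
      assoc_valuation V (x * y) = Some (g \<otimes>\<^bsub>value_group V\<^esub> h)"
    by (auto simp: assoc_valuation_def vg_mult split: if_splits)
  assume le: "val_le (value_group V) (assoc_valuation V x) (assoc_valuation V y)"
  show "val_le (value_group V) (assoc_valuation V x) (assoc_valuation V (x + y))"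
  proof (cases "x = 0 \<or> y = 0 \<or> x + y = 0")
    case True
    then show ?thesis
      using le vg_le[of x x] V_closed by (auto simp: val_le_def assoc_valuation_def split: if_splits)
  next
    case False
    then have "1 + y / x \<in> V"
      using le by (intro V_closed) (simp add: val_le_def assoc_valuation_def vg_le)
    then show ?thesis
      using False by (simp add: val_le_def assoc_valuation_def vg_le add_divide_distrib)
  qed
qed

lemma valuation_ring_assoc_valuation: "valuation_ring (value_group V) (assoc_valuation V) = V"
  using V_closed vg_le[of 1]
  by (auto simp: valuation_ring_def val_le_def assoc_valuation_def vg_one split: if_splits)

end

end

theory Submission
  imports Defs
begin

text \<open>
  Everything rests on Kaplansky's observation that, for a nonzero polynomial \<open>p\<close>, the value of
  \<open>p(s\<^sub>n)\<close> is eventually \<open>v a + k \<gamma>\<^sub>n\<close> for fixed \<open>a\<close> and \<open>k\<close>, where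
  \<open>\<gamma>\<^sub>n = v (s\<^sub>n\<^sub>+\<^sub>1 - s\<^sub>n)\<close>. As \<open>\<gamma>\<^sub>n\<close> increases, one of two such expressions with different \<open>k\<close>
  eventually dominates. If the values of all polynomials are eventually constant, we are done.
  Otherwise let \<open>q\<close> be of least degree among those for which this fails. The Taylor coefficients of \<open>q\<close>
  of positive order have eventually constant values, so in \<open>q(s\<^sub>m) - q(s\<^sub>n)\<close> a single Taylor term
  dominates; hence \<open>q(s\<^sub>n)\<close> is itself pseudo-convergent, and since its value is not eventually
  constant, it is the value of that term. Division by \<open>q\<close> then handles all other polynomials by
  induction on the degree. Consequently the values of two polynomials along the sequence are
  eventually comparable, always in the same way, which makes \<open>V\<^sub>E\<close> a valuation domain; its maximal
  ideal consists of its nonunits.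
\<close>

section \<open>Divisibility in a valuation domain\<close>

lemma ring_of_type_algebra_simps [simp]:
  "carrier (ring_of_type_algebra :: 'a::field ring) = UNIV"
  "x \<otimes>\<^bsub>ring_of_type_algebra :: 'a::field ring\<^esub> y = x * y"
  "\<one>\<^bsub>ring_of_type_algebra :: 'a::field ring\<^esub> = 1"
  "x \<oplus>\<^bsub>ring_of_type_algebra :: 'a::field ring\<^esub> y = x + y"
  "\<zero>\<^bsub>ring_of_type_algebra :: 'a::field ring\<^esub> = 0"
  by (simp_all add: ring_of_type_algebra_def)

lemma a_inv_ring_of_type_algebra [simp]: "\<ominus>\<^bsub>ring_of_type_algebra\<^esub> (x::'a::field) = - x"
proof -
  interpret R: Ring.field "ring_of_type_algebra :: 'a ring" by (rule field_from_type_algebra)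
  show ?thesis by (rule R.minus_equality) simp_all
qed

lemma subring_type_iff:
  "subring V (ring_of_type_algebra :: 'a::field ring) \<longleftrightarrow>
     1 \<in> V \<and> (\<forall>x\<in>V. - x \<in> V) \<and> (\<forall>x\<in>V. \<forall>y\<in>V. x + y \<in> V \<and> x * y \<in> V)"
proof -
  interpret R: Ring.field "ring_of_type_algebra :: 'a ring" by (rule field_from_type_algebra)
  show ?thesis
  proof
    assume "subring V (ring_of_type_algebra :: 'a ring)"
    note S = subringE[OF this, simplified]
    show "1 \<in> V \<and> (\<forall>x\<in>V. - x \<in> V) \<and> (\<forall>x\<in>V. \<forall>y\<in>V. x + y \<in> V \<and> x * y \<in> V)"
      using S by blast
  next
    assume "1 \<in> V \<and> (\<forall>x\<in>V. - x \<in> V) \<and> (\<forall>x\<in>V. \<forall>y\<in>V. x + y \<in> V \<and> x * y \<in> V)"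
    then show "subring V (ring_of_type_algebra :: 'a ring)"
      by (intro R.subringI) simp_all
  qed
qed

text \<open>\<open>v x \<le> v y\<close> is \<open>vdvd V x y\<close>, so that \<open>v x < v y\<close> is \<open>\<not> vdvd V y x\<close>; both cover
  the value \<open>\<infinity>\<close> of \<open>0\<close>.\<close>

definition vdvd :: "'a::field set \<Rightarrow> 'a \<Rightarrow> 'a \<Rightarrow> bool" where
  "vdvd V x y \<longleftrightarrow> (\<exists>z\<in>V. y = x * z)"

definition veq :: "'a::field set \<Rightarrow> 'a \<Rightarrow> 'a \<Rightarrow> bool" where
  "veq V x y \<longleftrightarrow> vdvd V x y \<and> vdvd V y x"

locale valuation_dom =
  fixes V :: "'a::field set"
  assumes dom: "valuation_domain V"
begin

lemma one_closed: "1 \<in> V"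
  and uminus_closed: "x \<in> V \<Longrightarrow> - x \<in> V"
  and add_closed: "x \<in> V \<Longrightarrow> y \<in> V \<Longrightarrow> x + y \<in> V"
  and mult_closed: "x \<in> V \<Longrightarrow> y \<in> V \<Longrightarrow> x * y \<in> V"
  and inverse_closed: "x \<noteq> 0 \<Longrightarrow> x \<notin> V \<Longrightarrow> inverse x \<in> V"
  using dom unfolding valuation_domain_def subring_type_iff by blast+

lemma zero_closed: "0 \<in> V"
  using add_closed[OF one_closed uminus_closed[OF one_closed]] by simp

lemma vdvd_refl [simp]: "vdvd V x x"
  unfolding vdvd_def using one_closed by (intro bexI[of _ 1]) simp_all

lemma vdvd_0_right [simp]: "vdvd V x 0"
  unfolding vdvd_def using zero_closed by (intro bexI[of _ 0]) simp_all

lemma vdvd_0_left [simp]: "vdvd V 0 x \<longleftrightarrow> x = 0"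
  unfolding vdvd_def using one_closed by auto

lemma vdvd_trans: "vdvd V x y \<Longrightarrow> vdvd V y z \<Longrightarrow> vdvd V x z"
  unfolding vdvd_def by (metis mult_closed mult.assoc)

lemma vdvd_iff_div: "x \<noteq> 0 \<Longrightarrow> vdvd V x y \<longleftrightarrow> y / x \<in> V"
  unfolding vdvd_def by (metis nonzero_mult_div_cancel_left nonzero_eq_divide_eq mult.commute)

lemma vdvd_total: "vdvd V x y \<or> vdvd V y x"
proof (cases "x = 0 \<or> y = 0")
  case False
  then show ?thesis using inverse_closed[of "y / x"] by (auto simp: vdvd_iff_div)
qed auto

lemma vdvd_add: "vdvd V x y \<Longrightarrow> vdvd V x z \<Longrightarrow> vdvd V x (y + z)"
  unfolding vdvd_def by (metis add_closed distrib_left)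

lemma vdvd_minus [simp]: "vdvd V x (- y) \<longleftrightarrow> vdvd V x y"
  unfolding vdvd_def by (metis uminus_closed mult_minus_right minus_minus)

lemma minus_vdvd [simp]: "vdvd V (- x) y \<longleftrightarrow> vdvd V x y"
  unfolding vdvd_def by (metis uminus_closed mult_minus_right mult_minus_left minus_minus)

lemma vdvd_mult: "vdvd V x y \<Longrightarrow> vdvd V z w \<Longrightarrow> vdvd V (x * z) (y * w)"
  unfolding vdvd_def
  apply (elim bexE)
  subgoal for a b by (rule bexI[of _ "a * b"]) (simp_all add: mult_closed)
  done

lemma vdvd_cancel: "c \<noteq> 0 \<Longrightarrow> vdvd V (c * x) (c * y) \<longleftrightarrow> vdvd V x y"
  unfolding vdvd_def by (auto simp: mult.assoc)

text \<open>As \<open>z\<close> divides \<open>w\<close>, \<open>y * z\<close> divides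
  \<open>y * w\<close>; if the latter divided \<open>x * z\<close>, cancelling \<open>z\<close>
  would make \<open>y\<close> divide \<open>x\<close>.\<close>

lemma not_vdvd_mult:
  assumes "\<not> vdvd V y x" "vdvd V z w" "z \<noteq> 0"
  shows "\<not> vdvd V (y * w) (x * z)"
proof
  assume "vdvd V (y * w) (x * z)"
  moreover have "vdvd V (y * z) (y * w)" using assms by (intro vdvd_mult) auto
  ultimately have "vdvd V (z * y) (z * x)" by (metis vdvd_trans mult.commute)
  then show False using assms by (simp add: vdvd_cancel)
qed

lemma veq_refl [simp]: "veq V x x"
  and veq_trans [trans]: "veq V x y \<Longrightarrow> veq V y z \<Longrightarrow> veq V x z"
  and veq_mult: "veq V x y \<Longrightarrow> veq V z w \<Longrightarrow> veq V (x * z) (y * w)"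
  and veq_uminus: "veq V x y \<Longrightarrow> veq V (- x) y"
  and veq_0_iff: "veq V x y \<Longrightarrow> x = 0 \<longleftrightarrow> y = 0"
  unfolding veq_def by (auto intro: vdvd_trans vdvd_mult)

lemma veq_power: "veq V x y \<Longrightarrow> veq V (x ^ n) (y ^ n)"
  by (induction n) (auto intro: veq_mult)

lemma vdvd_cong: "veq V x x' \<Longrightarrow> veq V y y' \<Longrightarrow> vdvd V x y \<longleftrightarrow> vdvd V x' y'"
  unfolding veq_def by (meson vdvd_trans)

text \<open>The equality case of the ultrametric inequality. To see that \<open>x + y\<close>
  divides \<open>x\<close>, write x = (x + y) - y: either \<open>x + y\<close> divides
  \<open>y\<close>, or \<open>y\<close> divides \<open>x + y\<close> and hence \<open>x\<close>,
  against the assumption.\<close>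

lemma veq_add:
  assumes "\<not> vdvd V y x"
  shows "veq V (x + y) x"
proof -
  have "vdvd V x y" using assms vdvd_total by blast
  then have "vdvd V x (x + y)" by (intro vdvd_add) auto
  moreover have "vdvd V (x + y) x"
  proof (cases "vdvd V (x + y) y")
    case True
    then have "vdvd V (x + y) (x + y + - y)" by (intro vdvd_add[of _ "x + y"]) simp_all
    then show ?thesis by simp
  next
    case False
    then have "vdvd V y (x + y + - y)" by (metis vdvd_add vdvd_minus vdvd_refl vdvd_total)
    then show ?thesis using assms by simp
  qed
  ultimately show ?thesis by (simp add: veq_def)
qed

end

section \<open>Arbitrary valuations expressed by divisibility in their rings\<close>

text \<open>Serves twice: for the given \<open>v\<close> on K, and for the valuation associated to
  \<open>eventually_in s V\<close> on K(X). Since y = x * (y / x), comparing \<open>v x\<close> with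
  \<open>v y\<close> amounts to comparing \<open>\<one>\<close> with
  \<open>v (y / x)\<close>.\<close>

lemma val_less_iff_not_vdvd:
  fixes G (structure)
  assumes "valuation G v" and "valuation_ring G v = V"
  shows "val_less G (v x) (v y) \<longleftrightarrow> \<not> vdvd V y x"
proof -
  interpret valuation G v by fact
  have le: "val_le G (v x) (v y) \<longleftrightarrow> vdvd V x y" for x y
  proof (cases "x = 0 \<or> y = 0")
    case True
    have "0 \<in> V" using assms v_infinite_iff[of 0] by (auto simp: valuation_ring_def val_le_def)
    then have "vdvd V x 0" by (auto simp: vdvd_def)
    moreover have "vdvd V 0 y \<longleftrightarrow> y = 0" using \<open>0 \<in> V\<close> by (auto simp: vdvd_def)
    moreover have "v 0 = None" using v_infinite_iff by blast
    moreover have "val_le G None (v y) \<longleftrightarrow> y = 0"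
      using v_infinite_iff[of y] by (cases "v y") (simp_all add: val_le_def)
    moreover have "val_le G (v x) None" by (simp add: val_le_def)
    ultimately show ?thesis using True by metis
  next
    case False
    then have nz: "x \<noteq> 0" "y \<noteq> 0" "y / x \<noteq> 0" by auto
    then obtain a b c where abc: "v x = Some a" "v y = Some b" "v (y / x) = Some c"
      using v_infinite_iff by (metis option.exhaust)
    then have car: "a \<in> carrier G" "b \<in> carrier G" "c \<in> carrier G" using v_closed by blast+
    have "Some b = Some (a \<otimes> c)" using v_mult[OF abc(1,3)] nz abc by simp
    then have b: "b = a \<otimes> c" by simp
    have "vdvd V x y \<longleftrightarrow> y / x \<in> V"
      using nz unfolding vdvd_def
      by (metis nonzero_mult_div_cancel_left nonzero_eq_divide_eq mult.commute)
    also have "\<dots> \<longleftrightarrow> \<one> \<preceq> c"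
      using assms(2) abc by (auto simp: valuation_ring_def val_le_def)
    also have "\<dots> \<longleftrightarrow> a \<preceq> b"
    proof
      assume "\<one> \<preceq> c"
      from vle_mult[OF one_closed car(3,1) this] show "a \<preceq> b"
        using car b by (simp add: m_comm)
    next
      assume "a \<preceq> b"
      from vle_mult[OF car(1,2) inv_closed[OF car(1)] this]
      have "a \<otimes> inv a \<preceq> (a \<otimes> c) \<otimes> inv a" using b by simp
      moreover have "(a \<otimes> c) \<otimes> inv a = c" using car by (simp add: m_comm[of a c] m_assoc)
      ultimately show "\<one> \<preceq> c" using car by simp
    qed
    finally show ?thesis using abc by (simp add: val_le_def)
  qed
  \<comment> \<open>The order axioms hold on the carrier only, hence the restriction to values of
    \<open>v\<close>. Totality and antisymmetry turn \<open>val_less\<close> into the negation of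
    the reversed \<open>val_le\<close>.\<close>
  have tot: "val_le G a b \<or> val_le G b a" "val_le G a b \<Longrightarrow> val_le G b a \<Longrightarrow> a = b"
    "val_le G a a" if "a \<in> range v" "b \<in> range v" for a b
    using that v_closed vle_total vle_antisym
    by (auto simp: val_le_def split: option.splits) (metis v_closed vle_total vle_antisym)+
  show ?thesis unfolding val_less_def le[symmetric]
    using tot[of "v x" "v y"] by auto
qed

section \<open>The maximal ideal as the set of nonunits\<close>

text \<open>Of two nonunits one divides the other and hence the sum, so nonunits form an ideal; it
  contains every proper ideal. The equivalence both identifies the given \<open>M\<close> and yields
  existence and uniqueness of the maximal ideal of \<open>eventually_in s V\<close>.\<close>

lemma maximalideal_valuation_domain_iff:
  assumes "valuation_domain (W :: 'a::field set)"
  shows "maximalideal N (subring_of W) \<longleftrightarrow> N = {x \<in> W. x = 0 \<or> inverse x \<notin> W}"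
proof -
  interpret valuation_dom W by unfold_locales fact
  interpret R: Ring.field "ring_of_type_algebra :: 'a ring" by (rule field_from_type_algebra)
  interpret W: ring "subring_of W"
    using assms R.subring_is_ring unfolding valuation_domain_def by blast
  define M where "M = {x \<in> W. x = 0 \<or> inverse x \<notin> W}"
  have M_vdvd: "x \<in> M \<longleftrightarrow> x \<in> W \<and> \<not> vdvd W x 1" for x
    by (cases "x = 0") (auto simp: M_def vdvd_iff_div inverse_eq_divide)
  have a_inv_W: "\<ominus>\<^bsub>subring_of W\<^esub> x = - x" if "x \<in> W" for x
    using that uminus_closed by (intro W.minus_equality) auto
  have idealM: "ideal M (subring_of W)"
  proof (rule idealI)
    show "ring (subring_of W)" by (rule W.ring_axioms)
    show "subgroup M (add_monoid (subring_of W))"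
    proof (rule W.add.subgroupI)
      show "M \<subseteq> carrier (subring_of W)" by (auto simp: M_def)
      show "M \<noteq> {}" using zero_closed by (auto simp: M_def)
      fix a assume a: "a \<in> M"
      then show "\<ominus>\<^bsub>subring_of W\<^esub> a \<in> M"
        using a_inv_W[of a] uminus_closed by (auto simp: M_vdvd)
      fix b assume b: "b \<in> M"
      have "\<not> vdvd W (a + b) 1"
        using a b vdvd_total[of a b] vdvd_trans vdvd_add vdvd_refl unfolding M_vdvd by metis
      then show "a \<oplus>\<^bsub>subring_of W\<^esub> b \<in> M"
        using a b add_closed by (auto simp: M_vdvd)
    qed
    fix a x assume a: "a \<in> M" and "x \<in> carrier (subring_of W)"
    then have x: "x \<in> W" by simp
    have "vdvd W a (x * a)" using x by (auto simp: vdvd_def)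
    then have "x * a \<in> M" using a x vdvd_trans mult_closed unfolding M_vdvd by blast
    then show "x \<otimes>\<^bsub>subring_of W\<^esub> a \<in> M" "a \<otimes>\<^bsub>subring_of W\<^esub> x \<in> M"
      by (simp_all add: mult.commute)
  qed
  have sub: "J \<subseteq> M" if J: "ideal J (subring_of W)" "J \<noteq> W" for J
  proof
    fix x assume x: "x \<in> J"
    interpret J: ideal J "subring_of W" by (rule J)
    have xW: "x \<in> W" using J.a_subset x by auto
    show "x \<in> M"
    proof (rule ccontr)
      assume "x \<notin> M"
      then have nz: "x \<noteq> 0" "inverse x \<in> W" using xW by (auto simp: M_def)
      then have "\<one>\<^bsub>subring_of W\<^esub> \<in> J" using J.I_l_closed[OF x, of "inverse x"] by simp
      then show False using J.one_imp_carrier J(2) by simp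
    qed
  qed
  have M_ne: "M \<noteq> W" using one_closed M_vdvd[of 1] by auto
  have "maximalideal M (subring_of W)"
    using idealM M_ne sub by (intro maximalidealI) (auto dest: ideal.Icarr)
  moreover have "N = M" if "maximalideal N (subring_of W)"
  proof -
    interpret N: maximalideal N "subring_of W" by (rule that)
    have "N \<noteq> W" using N.I_notcarr by auto
    then have "N \<subseteq> M" using sub N.is_ideal by blast
    then show ?thesis
      using N.I_maximal[OF idealM] M_ne by (auto simp: M_def)
  qed
  ultimately show ?thesis unfolding M_def by blast
qed

section \<open>Taylor expansion of polynomials\<close>

text \<open>\<open>P i\<close> plays the part of the i-th Hasse derivative; no factorial is
  inverted, so positive characteristic is covered. The degree bound makes \<open>P i\<close> vanish
  for \<open>i\<close> beyond \<open>degree p\<close>.\<close>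

lemma taylor_expansion:
  fixes p :: "'a::field poly"
  shows "\<exists>P. P 0 = p \<and> (\<forall>i. degree (P i) + i \<le> degree p \<or> P i = 0) \<and>
    (\<forall>x h. poly p (x + h) = (\<Sum>i\<le>degree p. poly (P i) x * h ^ i))"
proof (induction p rule: pCons_induct)
  case 0
  show ?case by (intro exI[of _ "\<lambda>_. 0"]) auto
next
  case (pCons a p)
  then obtain P where P: "P 0 = p" "\<And>i. degree (P i) + i \<le> degree p \<or> P i = 0"
    "\<And>x h. poly p (x + h) = (\<Sum>i\<le>degree p. poly (P i) x * h ^ i)" by blast
  show ?case
  proof (cases "p = 0")
    case True
    then show ?thesis by (intro exI[of _ "\<lambda>i. if i = 0 then [:a:] else 0"]) auto
  next
    case False
    \<comment> \<open>The coefficients of h^i in a + (x + h) * p(x + h), with p(x + h) expanded by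
      the induction hypothesis.\<close>
    define Q where "Q i = (case i of 0 \<Rightarrow> pCons a p | Suc j \<Rightarrow> pCons 0 (P (Suc j)) + P j)" for i
    have "degree (Q i) + i \<le> degree (pCons a p) \<or> Q i = 0" for i
    proof (cases i)
      case 0
      then show ?thesis by (simp add: Q_def)
    next
      case (Suc j)
      have "degree (pCons 0 (P (Suc j))) + i \<le> degree p + 1 \<or> P (Suc j) = 0"
        using P(2)[of "Suc j"] Suc by (cases "P (Suc j) = 0") auto
      moreover have "degree (P j) + i \<le> degree p + 1 \<or> P j = 0" using P(2)[of j] Suc by auto
      moreover have "degree (Q i) \<le> max (degree (pCons 0 (P (Suc j)))) (degree (P j))"
        unfolding Q_def Suc nat.case by (rule degree_add_le_max)
      ultimately show ?thesis using False Suc by (auto simp: Q_def)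
    qed
    moreover have "poly (pCons a p) (x + h) = (\<Sum>i\<le>degree (pCons a p). poly (Q i) x * h ^ i)"
      for x h
    proof -
      have top: "P (Suc (degree p)) = 0" using P(2)[of "Suc (degree p)"] by auto
      have shift: "poly p (x + h) = poly p x + (\<Sum>i\<le>degree p. poly (P (Suc i)) x * h ^ Suc i)"
        using sum.atMost_Suc_shift[of "\<lambda>i. poly (P i) x * h ^ i" "degree p"] top
        by (simp add: P(1,3))
      have "(\<Sum>i\<le>degree (pCons a p). poly (Q i) x * h ^ i) = poly (pCons a p) x +
          (\<Sum>i\<le>degree p. (x * poly (P (Suc i)) x + poly (P i) x) * h ^ Suc i)"
        using False by (simp add: sum.atMost_Suc_shift Q_def del: sum.atMost_Suc)
      also have "\<dots> = poly (pCons a p) x + x * (\<Sum>i\<le>degree p. poly (P (Suc i)) x * h ^ Suc i)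
          + h * (\<Sum>i\<le>degree p. poly (P i) x * h ^ i)"
        by (simp add: sum_distrib_left sum.distrib[symmetric] algebra_simps)
      also have "(\<Sum>i\<le>degree p. poly (P i) x * h ^ i) = poly p (x + h)" by (simp add: P(3))
      also have "(\<Sum>i\<le>degree p. poly (P (Suc i)) x * h ^ Suc i) = poly p (x + h) - poly p x"
        using shift by simp
      finally show ?thesis by (simp add: algebra_simps)
    qed
    ultimately show ?thesis by (intro exI[of _ Q]) (simp add: Q_def)
  qed
qed

section \<open>Values of polynomials along a pseudo-convergent sequence\<close>

locale pseudo_convergent_seq = valuation_dom V for V :: "'a::field set" +
  fixes s :: "nat \<Rightarrow> 'a"
  assumes pc: "\<not> vdvd V (s (n + 2) - s (n + 1)) (s (n + 1) - s n)"
begin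

abbreviation gap :: "nat \<Rightarrow> 'a" where "gap n \<equiv> s (Suc n) - s n"

lemma gap_nz: "gap n \<noteq> 0"
  using pc[of n] by auto

lemma gap_less: "n < m \<Longrightarrow> \<not> vdvd V (gap m) (gap n)"
proof (induction m rule: less_Suc_induct)
  case (1 i)
  then show ?case using pc[of i] by simp
next
  case (2 i j k)
  then show ?case using vdvd_total vdvd_trans by blast
qed

lemma gap_power_less:
  assumes "n < m" "1 \<le> k"
  shows "\<not> vdvd V (gap m ^ k) (gap n ^ k)"
proof -
  obtain j where k: "k = Suc j" using assms(2) by (cases k) auto
  have "vdvd V (gap n) (gap m)" using gap_less[OF assms(1)] vdvd_total by blast
  then have "vdvd V (gap n ^ j) (gap m ^ j)" by (induction j) (auto intro: vdvd_mult)
  then show ?thesis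
    unfolding k power_Suc using gap_less[OF assms(1)] gap_nz[of n] by (intro not_vdvd_mult) auto
qed

text \<open>In s_k - s_i = (s_k - s_j) + (s_j - s_i) the second summand has the strictly smaller
  value.\<close>

lemma diff_veq_gap: "n < m \<Longrightarrow> veq V (s m - s n) (gap n)"
proof (induction n m rule: less_Suc_induct)
  case (1 i)
  show ?case by simp
next
  case (2 i j k)
  have "\<not> vdvd V (s k - s j) (s j - s i)"
    using vdvd_cong[OF 2(4,3)] gap_less[OF 2(1)] by simp
  from veq_add[OF this] have "veq V (s k - s i) (s j - s i)" by simp
  then show ?case using 2(3) by (rule veq_trans)
qed

lemma inj_s: "inj s"
proof (rule linorder_injI)
  fix n m :: nat assume "n < m"
  from veq_0_iff[OF diff_veq_gap[OF this]] show "s n \<noteq> s m" using gap_nz[of n] by auto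
qed

section \<open>Growth rates and their comparison\<close>

text \<open>The second index \<open>m\<close> makes room for the differences \<open>p (s m) - p (s n)\<close>, whose value
  does not depend on \<open>m\<close>.\<close>

definition has_growth :: "(nat \<Rightarrow> nat \<Rightarrow> 'a) \<Rightarrow> 'a \<Rightarrow> nat \<Rightarrow> bool" where
  "has_growth F a k \<longleftrightarrow>
     a \<noteq> 0 \<and> (\<forall>\<^sub>F n in sequentially. \<forall>m>n. veq V (F n m) (a * gap n ^ k))"

text \<open>The gap at \<open>n\<close> is the gap at \<open>N\<close> times a nonunit
  \<open>t\<close> of \<open>V\<close>, so on the way from \<open>N\<close> to \<open>n\<close> the
  term with exponent \<open>l\<close> gains \<open>l - k\<close> more factors \<open>t\<close> than
  the other. This makes a weak inequality strict.\<close>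

lemma growth_less:
  assumes "a \<noteq> 0" "k < l" "vdvd V (a * gap N ^ k) (b * gap N ^ l)" "N < n"
  shows "\<not> vdvd V (b * gap n ^ l) (a * gap n ^ k)"
proof -
  have "vdvd V (gap N) (gap n)" using gap_less[OF assms(4)] vdvd_total by blast
  then obtain t where t: "t \<in> V" "gap n = gap N * t" by (auto simp: vdvd_def)
  have nz: "t \<noteq> 0" using t gap_nz[of n] by auto
  have t1: "\<not> vdvd V t 1" using gap_less[OF assms(4)] t vdvd_cancel[OF gap_nz, of N t 1] by simp
  have pow: "\<not> vdvd V (t ^ Suc j) 1" for j
  proof
    assume "vdvd V (t ^ Suc j) 1"
    moreover have "t ^ j \<in> V" using t(1) by (induction j) (auto intro: one_closed mult_closed)
    then have "vdvd V t (t ^ Suc j)" by (auto simp: vdvd_def)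
    ultimately show False using t1 vdvd_trans by blast
  qed
  obtain j where l: "l = k + Suc j" using assms(2) less_iff_Suc_add by auto
  have "\<not> vdvd V (t ^ Suc j * (b * gap N ^ l)) (1 * (a * gap N ^ k))"
    using assms(1,3) gap_nz[of N] by (intro not_vdvd_mult pow) auto
  then have "\<not> vdvd V (t ^ k * (t ^ Suc j * (b * gap N ^ l))) (t ^ k * (1 * (a * gap N ^ k)))"
    using nz by (simp only: vdvd_cancel power_eq_0_iff not_False_eq_True simp_thms)
  then show ?thesis by (simp add: t(2) power_mult_distrib l power_add mult_ac)
qed

text \<open>If the comparison in \<open>growth_less\<close> holds at some index, it is strict from
  there on; otherwise the opposite strict inequality holds everywhere. The values of the gaps may be
  bounded, so either term can win.\<close>

lemma growth_dominance:
  assumes "a \<noteq> 0" "k < l"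
  shows "(\<forall>\<^sub>F n in sequentially. \<not> vdvd V (b * gap n ^ l) (a * gap n ^ k)) \<or>
    (\<forall>\<^sub>F n in sequentially. \<not> vdvd V (a * gap n ^ k) (b * gap n ^ l))"
proof (cases "\<exists>N. vdvd V (a * gap N ^ k) (b * gap N ^ l)")
  case True
  then obtain N where "vdvd V (a * gap N ^ k) (b * gap N ^ l)" by blast
  then have "\<forall>n>N. \<not> vdvd V (b * gap n ^ l) (a * gap n ^ k)"
    using growth_less assms by blast
  then show ?thesis using eventually_at_top_dense by blast
qed auto

lemma has_growth_dominant_add:
  assumes F: "has_growth F a k" and H: "has_growth H b l"
    and less: "\<forall>\<^sub>F n in sequentially. \<not> vdvd V (b * gap n ^ l) (a * gap n ^ k)"
  shows "has_growth (\<lambda>n m. F n m + H n m) a k"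
  unfolding has_growth_def
proof
  show "a \<noteq> 0" using F by (simp add: has_growth_def)
  have "\<forall>\<^sub>F n in sequentially. \<forall>m>n. veq V (F n m) (a * gap n ^ k)"
    "\<forall>\<^sub>F n in sequentially. \<forall>m>n. veq V (H n m) (b * gap n ^ l)"
    using F H by (simp_all add: has_growth_def)
  then show "\<forall>\<^sub>F n in sequentially. \<forall>m>n. veq V (F n m + H n m) (a * gap n ^ k)"
    using less
  proof eventually_elim
    case (elim n)
    show ?case
    proof (intro allI impI)
      fix m assume m: "n < m"
      have "\<not> vdvd V (H n m) (F n m)"
        using elim m vdvd_cong[of "H n m" "b * gap n ^ l" "F n m" "a * gap n ^ k"] by blast
      from veq_add[OF this] show "veq V (F n m + H n m) (a * gap n ^ k)"
        using elim m veq_trans by blast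
    qed
  qed
qed

lemma has_growth_add:
  assumes "has_growth F a k" "has_growth H b l" "k \<noteq> l"
  shows "has_growth (\<lambda>n m. F n m + H n m) a k \<or> has_growth (\<lambda>n m. F n m + H n m) b l"
proof -
  have nz: "a \<noteq> 0" "b \<noteq> 0" using assms by (auto simp: has_growth_def)
  have "(\<forall>\<^sub>F n in sequentially. \<not> vdvd V (b * gap n ^ l) (a * gap n ^ k)) \<or>
    (\<forall>\<^sub>F n in sequentially. \<not> vdvd V (a * gap n ^ k) (b * gap n ^ l))"
    using growth_dominance[of a k l b] growth_dominance[of b l k a] nz assms(3)
    by (meson linorder_neqE_nat)
  then show ?thesis
    using has_growth_dominant_add[OF assms(1,2)] has_growth_dominant_add[OF assms(2,1)]
    by (auto simp: add.commute)
qed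

lemma has_growth_mult:
  assumes F: "has_growth F a k" and H: "has_growth H b l"
  shows "has_growth (\<lambda>n m. F n m * H n m) (a * b) (k + l)"
  unfolding has_growth_def
proof
  show "a * b \<noteq> 0" using F H by (simp add: has_growth_def)
  have "\<forall>\<^sub>F n in sequentially. \<forall>m>n. veq V (F n m) (a * gap n ^ k)"
    "\<forall>\<^sub>F n in sequentially. \<forall>m>n. veq V (H n m) (b * gap n ^ l)"
    using F H by (simp_all add: has_growth_def)
  then show "\<forall>\<^sub>F n in sequentially. \<forall>m>n. veq V (F n m * H n m) (a * b * gap n ^ (k + l))"
  proof eventually_elim
    case (elim n)
    have "a * b * gap n ^ (k + l) = (a * gap n ^ k) * (b * gap n ^ l)"
      by (simp add: power_add mult_ac)
    then show ?case using elim by (metis veq_mult)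
  qed
qed

lemma has_growth_diff_power: "has_growth (\<lambda>n m. (s m - s n) ^ k) 1 k"
  unfolding has_growth_def by (auto intro!: always_eventually veq_power diff_veq_gap)

section \<open>Growth of polynomials\<close>

text \<open>Exponent \<open>0\<close> means that the value of p(s_n) is eventually constant and
  finite.\<close>

abbreviation poly_growth :: "'a poly \<Rightarrow> 'a \<Rightarrow> nat \<Rightarrow> bool" where
  "poly_growth p \<equiv> has_growth (\<lambda>n m. poly p (s n))"

text \<open>A nonzero Taylor coefficient of order i \<ge> 1 has smaller degree than
  \<open>q\<close>, so its term has growth exponent exactly i. Distinct exponents rule out
  cancellation. The first alternative covers the case that all these coefficients vanish.\<close>

lemma ex_poly_growth_difference:
  assumes const: "\<And>r. r \<noteq> 0 \<Longrightarrow> degree r < degree q \<Longrightarrow> \<exists>a. poly_growth r a 0"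
  shows "(\<forall>n m. poly q (s m) = poly q (s n)) \<or>
    (\<exists>a k. 1 \<le> k \<and> k \<le> degree q \<and> has_growth (\<lambda>n m. poly q (s m) - poly q (s n)) a k)"
proof -
  obtain P where P: "P 0 = q" "\<And>i. degree (P i) + i \<le> degree q \<or> P i = 0"
    "\<And>x h. poly q (x + h) = (\<Sum>i\<le>degree q. poly (P i) x * h ^ i)"
    using taylor_expansion[of q] by blast
  define S where "S j n m = (\<Sum>i=1..j. poly (P i) (s n) * (s m - s n) ^ i)" for j n m
  \<comment> \<open>The bound \<open>k \<le> j\<close> keeps the exponent of a partial sum different
    from the exponent \<open>Suc j\<close> of the next term.\<close>
  have "(\<forall>n m. S j n m = 0) \<or> (\<exists>a k. 1 \<le> k \<and> k \<le> j \<and> has_growth (S j) a k)" for j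
  proof (induction j)
    case 0
    show ?case by (simp add: S_def)
  next
    case (Suc j)
    define T where "T n m = poly (P (Suc j)) (s n) * (s m - s n) ^ Suc j" for n m
    have S: "S (Suc j) = (\<lambda>n m. S j n m + T n m)" by (intro ext) (simp add: S_def T_def)
    show ?case
    proof (cases "P (Suc j) = 0")
      case True
      then have "S (Suc j) = S j" by (simp add: S T_def)
      then show ?thesis using Suc by (metis le_SucI)
    next
      case False
      then have "degree (P (Suc j)) < degree q" using P(2)[of "Suc j"] by auto
      then obtain b where "poly_growth (P (Suc j)) b 0" using const False by blast
      from has_growth_mult[OF this has_growth_diff_power[of "Suc j"]]
      have T: "has_growth T b (Suc j)" by (simp add: T_def[abs_def])
      from Suc.IH show ?thesis
      proof
        assume "\<forall>n m. S j n m = 0"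
        then show ?thesis using T by (auto simp: S)
      next
        assume "\<exists>a k. 1 \<le> k \<and> k \<le> j \<and> has_growth (S j) a k"
        then obtain a k where ak: "1 \<le> k" "k \<le> j" "has_growth (S j) a k" by blast
        then have "has_growth (S (Suc j)) a k \<or> has_growth (S (Suc j)) b (Suc j)"
          using has_growth_add[OF ak(3) T] by (simp add: S)
        then show ?thesis using ak le_SucI by fastforce
      qed
    qed
  qed
  moreover have "S (degree q) n m = poly q (s m) - poly q (s n)" for n m
  proof -
    have "poly q (s m) = (\<Sum>i\<le>degree q. poly (P i) (s n) * (s m - s n) ^ i)"
      using P(3)[of "s n" "s m - s n"] by simp
    also have "\<dots> = poly q (s n) + S (degree q) n m"
      by (simp add: S_def atMost_atLeast0 sum.atLeast_Suc_atMost P(1))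
    finally show ?thesis by simp
  qed
  then have "S (degree q) = (\<lambda>n m. poly q (s m) - poly q (s n))" by (intro ext)
  ultimately show ?thesis by (metis eq_iff_diff_eq_0)
qed

lemma ex_poly_growth_minimal:
  assumes const: "\<And>r. r \<noteq> 0 \<Longrightarrow> degree r < degree q \<Longrightarrow> \<exists>a. poly_growth r a 0"
    and q: "q \<noteq> 0" "\<nexists>a. poly_growth q a 0"
  shows "\<exists>a k. 1 \<le> k \<and> k \<le> degree q \<and> poly_growth q a k"
proof -
  \<comment> \<open>Constancy along the sequence would give infinitely many roots, \<open>s\<close>
    being injective, or growth of exponent \<open>0\<close>.\<close>
  have not_const: "\<not> (\<forall>n m. poly q (s m) = poly q (s n))"
  proof
    assume eq: "\<forall>n m. poly q (s m) = poly q (s n)"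
    show False
    proof (cases "poly q (s 0) = 0")
      case True
      then have "range s \<subseteq> {x. poly q x = 0}" using eq by (metis (mono_tags) image_subsetI mem_Collect_eq)
      then show False
        using poly_roots_finite[OF q(1)] inj_s finite_imageD finite_subset infinite_UNIV_nat
        by metis
    next
      case False
      have "veq V (poly q (s n)) (poly q (s 0))" for n using eq veq_refl by metis
      then have "poly_growth q (poly q (s 0)) 0" using False by (simp add: has_growth_def)
      then show False using q by blast
    qed
  qed
  then obtain a k where ak: "1 \<le> k" "k \<le> degree q"
      and diff: "has_growth (\<lambda>n m. poly q (s m) - poly q (s n)) a k"
    using ex_poly_growth_difference[OF const] by blast
  then have a: "a \<noteq> 0" by (simp add: has_growth_def)
  obtain N where N: "\<And>n m. n \<ge> N \<Longrightarrow> n < m \<Longrightarrow>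
      veq V (poly q (s m) - poly q (s n)) (a * gap n ^ k)"
    using diff unfolding has_growth_def eventually_sequentially by blast
  \<comment> \<open>If q(s_n) had smaller value than the later differences q(s_m) - q(s_n), every
    later q(s_m) would have the value of q(s_n), giving growth of exponent \<open>0\<close>.\<close>
  have ge: "vdvd V (a * gap n ^ k) (poly q (s n))" if n: "n \<ge> N" for n
  proof (rule ccontr)
    assume less: "\<not> vdvd V (a * gap n ^ k) (poly q (s n))"
    have "veq V (poly q (s m)) (poly q (s n))" if "n < m" for m
    proof -
      have "\<not> vdvd V (poly q (s m) - poly q (s n)) (poly q (s n))"
        using less vdvd_cong[OF N[OF n that] veq_refl] by blast
      from veq_add[OF this] show ?thesis by simp
    qed
    then have "\<forall>m>n. veq V (poly q (s m)) (poly q (s n))" by blast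
    then have "\<forall>\<^sub>F m in sequentially. veq V (poly q (s m)) (poly q (s n))"
      using eventually_at_top_dense by blast
    moreover have "poly q (s n) \<noteq> 0" using less by auto
    ultimately have "poly_growth q (poly q (s n)) 0"
      unfolding has_growth_def by (auto elim: eventually_mono)
    then show False using q by blast
  qed
  \<comment> \<open>In q(s_n) = q(s_(n+1)) - d, by \<open>ge\<close> the value of q(s_(n+1)) is at
    least that of \<open>a * gap (Suc n) ^ k\<close>, hence larger than that of d. So d determines
    the value.\<close>
  have "veq V (poly q (s n)) (a * gap n ^ k)" if n: "n \<ge> N" for n
  proof -
    let ?d = "poly q (s (Suc n)) - poly q (s n)"
    have "\<not> vdvd V (a * gap (Suc n) ^ k) (a * gap n ^ k)"
      using gap_power_less[of n "Suc n" k] ak(1) a by (simp add: vdvd_cancel)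
    then have less: "\<not> vdvd V (poly q (s (Suc n))) (a * gap n ^ k)"
      using ge[of "Suc n"] n vdvd_trans by auto
    have d: "veq V ?d (a * gap n ^ k)" using N[OF n, of "Suc n"] by simp
    have "\<not> vdvd V (poly q (s (Suc n))) (- ?d)"
      using less vdvd_cong[OF veq_refl d] vdvd_minus by blast
    from veq_add[OF this] have "veq V (poly q (s n)) (- ?d)" by simp
    then show ?thesis using veq_uminus[OF d] veq_trans by blast
  qed
  then have "poly_growth q a k"
    using a unfolding has_growth_def eventually_sequentially by blast
  then show ?thesis using ak by blast
qed

lemma ex_poly_growth:
  assumes "p \<noteq> 0"
  shows "\<exists>a k. poly_growth p a k"
proof (cases "\<forall>q. q \<noteq> 0 \<longrightarrow> (\<exists>a. poly_growth q a 0)")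
  case True
  then show ?thesis using assms by blast
next
  case False
  then obtain q0 where "q0 \<noteq> 0 \<and> (\<nexists>a. poly_growth q0 a 0)" by blast
  from ex_has_least_nat[where P = "\<lambda>q. q \<noteq> 0 \<and> (\<nexists>a. poly_growth q a 0)" and m = degree, OF this]
  obtain q where q: "q \<noteq> 0" "\<nexists>a. poly_growth q a 0"
      and min: "\<And>r. r \<noteq> 0 \<and> (\<nexists>a. poly_growth r a 0) \<Longrightarrow> degree q \<le> degree r"
    by auto
  have const: "\<exists>a. poly_growth r a 0" if "r \<noteq> 0" "degree r < degree q" for r
    using min[of r] that by (meson not_less)
  obtain a k where ak: "1 \<le> k" "k \<le> degree q" "poly_growth q a k"
    using ex_poly_growth_minimal[OF const q] by blast
  show ?thesis using assms
  proof (induction "degree p" arbitrary: p rule: less_induct)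
    case less
    show ?case
    proof (cases "degree p < degree q")
      case True
      then show ?thesis using const less.prems by blast
    next
      case False
      \<comment> \<open>The product \<open>q * g\<close> gets the exponent
        \<open>k + l \<ge> 1\<close> and a nonzero remainder the exponent \<open>0\<close>, so the
        two can be added. The quotient has smaller degree because
        \<open>1 \<le> k \<le> degree q\<close>.\<close>
      define g r where "g = p div q" and "r = p mod q"
      have p: "p = q * g + r" by (simp add: g_def r_def)
      have "g \<noteq> 0"
      proof
        assume "g = 0"
        then have "p = r" using p by simp
        then show False
          using False degree_mod_less[OF q(1), of p] less.prems by (auto simp: r_def)
      qed
      moreover have "degree g < degree p"
        using degree_div_less[of p q] False ak by (simp add: g_def)
      ultimately obtain b l where "poly_growth g b l" using less.hyps by blast
      from has_growth_mult[OF ak(3) this]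
      have qg: "has_growth (\<lambda>n m. poly q (s n) * poly g (s n)) (a * b) (k + l)" .
      show ?thesis
      proof (cases "r = 0")
        case True
        then show ?thesis using qg p by auto
      next
        case r: False
        then have "degree r < degree q" using degree_mod_less[OF q(1), of p] by (auto simp: r_def)
        then obtain c where "poly_growth r c 0" using const r by blast
        from has_growth_add[OF qg this] show ?thesis using ak(1) by (auto simp: p)
      qed
    qed
  qed
qed

text \<open>Different exponents are settled by \<open>growth_dominance\<close>; for equal ones the
  power of the gap cancels and the fixed \<open>a\<close> and \<open>b\<close> are compared. Strict
  and equal values are kept apart in order to recognize units.\<close>

lemma poly_trichotomy:
  assumes "p \<noteq> 0" "q \<noteq> 0"
  shows "(\<forall>\<^sub>F n in sequentially. \<not> vdvd V (poly q (s n)) (poly p (s n))) \<or>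
    (\<forall>\<^sub>F n in sequentially. \<not> vdvd V (poly p (s n)) (poly q (s n))) \<or>
    (\<forall>\<^sub>F n in sequentially. veq V (poly p (s n)) (poly q (s n)))"
proof -
  obtain a k b l where "poly_growth p a k" "poly_growth q b l"
    using ex_poly_growth assms by meson
  then have nz: "a \<noteq> 0" "b \<noteq> 0"
    and p: "\<forall>\<^sub>F n in sequentially. \<forall>m>n. veq V (poly p (s n)) (a * gap n ^ k)"
    and q: "\<forall>\<^sub>F n in sequentially. \<forall>m>n. veq V (poly q (s n)) (b * gap n ^ l)"
    by (simp_all add: has_growth_def)
  from p q have pq: "\<forall>\<^sub>F n in sequentially.
      (vdvd V (poly p (s n)) (poly q (s n)) \<longleftrightarrow> vdvd V (a * gap n ^ k) (b * gap n ^ l)) \<and>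
      (vdvd V (poly q (s n)) (poly p (s n)) \<longleftrightarrow> vdvd V (b * gap n ^ l) (a * gap n ^ k))"
    by eventually_elim (meson gt_ex vdvd_cong)
  consider "\<forall>\<^sub>F n in sequentially. \<not> vdvd V (b * gap n ^ l) (a * gap n ^ k)"
    | "\<forall>\<^sub>F n in sequentially. \<not> vdvd V (a * gap n ^ k) (b * gap n ^ l)"
    | "k = l" "veq V a b"
  proof (cases "k = l")
    case True
    have "vdvd V (c * gap n ^ l) (d * gap n ^ l) \<longleftrightarrow> vdvd V c d" for c d n
      using gap_nz[of n] vdvd_cancel[of "gap n ^ l" c d] by (simp add: mult.commute)
    then show ?thesis using that True by (auto simp: veq_def)
  next
    case False
    then show ?thesis
      using that growth_dominance[of a k l b] growth_dominance[of b l k a] nz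
      by (meson linorder_neqE_nat)
  qed
  then show ?thesis
  proof cases
    case 1
    with pq have "\<forall>\<^sub>F n in sequentially. \<not> vdvd V (poly q (s n)) (poly p (s n))"
      by eventually_elim simp
    then show ?thesis by blast
  next
    case 2
    with pq have "\<forall>\<^sub>F n in sequentially. \<not> vdvd V (poly p (s n)) (poly q (s n))"
      by eventually_elim simp
    then show ?thesis by blast
  next
    case 3
    then have "veq V (a * gap n ^ k) (b * gap n ^ l)" for n by (auto intro: veq_mult)
    with pq have "\<forall>\<^sub>F n in sequentially. veq V (poly p (s n)) (poly q (s n))"
      by (auto simp: veq_def elim: eventually_mono)
    then show ?thesis by blast
  qed
qed

lemma poly_eventually_nonzero:
  assumes "p \<noteq> 0"
  shows "\<forall>\<^sub>F n in sequentially. poly p (s n) \<noteq> 0"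
proof -
  have "finite (s -` {x. poly p x = 0})"
    using poly_roots_finite[OF assms] inj_s by (rule finite_vimageI)
  then show ?thesis
    unfolding cofinite_eq_sequentially[symmetric] eventually_cofinite by (simp add: vimage_def)
qed

section \<open>The valuation domain of a pseudo-convergent sequence\<close>

text \<open>Any representation of the fraction may be used: its denominator vanishes at only
  finitely many s_n.\<close>

lemma Fract_mem_eventually_in:
  assumes "q \<noteq> 0"
  shows "Fract p q \<in> eventually_in s A \<longleftrightarrow>
    (\<forall>\<^sub>F n in sequentially. poly p (s n) / poly q (s n) \<in> A)"
  unfolding eventually_in_def mem_Collect_eq cofinite_eq_sequentially
proof (rule eventually_subst)
  show "\<forall>\<^sub>F n in sequentially.
      (rf_defined_at (Fract p q) (s n) \<and> rf_eval (Fract p q) (s n) \<in> A) =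
      (poly p (s n) / poly q (s n) \<in> A)"
    using poly_eventually_nonzero[OF assms]
    by eventually_elim (auto simp: rf_eval_Fract rf_defined_at_def)
qed

lemma rf_const_mem_eventually_in: "rf_const c \<in> eventually_in s A \<longleftrightarrow> c \<in> A"
  by (simp add: rf_const_def to_fract_def Fract_mem_eventually_in)

text \<open>The ring axioms are inherited pointwise; that x or its inverse belongs to the ring comes
  from \<open>poly_trichotomy\<close> for numerator and denominator.\<close>

lemma valuation_domain_eventually_in: "valuation_domain (eventually_in s V)"
  unfolding valuation_domain_def subring_type_iff
proof (intro conjI ballI allI impI)
  show "1 \<in> eventually_in s V"
    by (simp add: One_fract_def Fract_mem_eventually_in one_closed)
next
  fix x assume x: "x \<in> eventually_in s V"
  obtain p q where "x = Fract p q" "q \<noteq> 0" by (cases x)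
  with x show "- x \<in> eventually_in s V"
    by (auto simp: Fract_mem_eventually_in elim!: eventually_mono dest: uminus_closed)
next
  fix x y assume xy: "x \<in> eventually_in s V" "y \<in> eventually_in s V"
  obtain p q where x: "x = Fract p q" "q \<noteq> 0" by (cases x)
  obtain p' q' where y: "y = Fract p' q'" "q' \<noteq> 0" by (cases y)
  have ev: "\<forall>\<^sub>F n in sequentially. poly p (s n) / poly q (s n) \<in> V"
    "\<forall>\<^sub>F n in sequentially. poly p' (s n) / poly q' (s n) \<in> V"
    using xy x y by (simp_all add: Fract_mem_eventually_in)
  have "\<forall>\<^sub>F n in sequentially. poly (p * q' + p' * q) (s n) / poly (q * q') (s n) \<in> V"
    using ev poly_eventually_nonzero[OF x(2)] poly_eventually_nonzero[OF y(2)]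
  proof eventually_elim
    case (elim n)
    then show ?case using add_closed[OF elim(1,2)] by (simp add: add_frac_eq)
  qed
  then show "x + y \<in> eventually_in s V" using x y by (simp add: Fract_mem_eventually_in)
  have "\<forall>\<^sub>F n in sequentially. poly (p * p') (s n) / poly (q * q') (s n) \<in> V"
    using ev by eventually_elim (use mult_closed in fastforce)
  then show "x * y \<in> eventually_in s V" using x y by (simp add: Fract_mem_eventually_in)
next
  fix x :: "'a poly fract" assume "x \<noteq> 0"
  obtain p q where x: "x = Fract p q" "q \<noteq> 0" by (cases x)
  with \<open>x \<noteq> 0\<close> have p: "p \<noteq> 0" by (auto simp: Zero_fract_def eq_fract)
  have "(\<forall>\<^sub>F n in sequentially. vdvd V (poly q (s n)) (poly p (s n))) \<or>
    (\<forall>\<^sub>F n in sequentially. vdvd V (poly p (s n)) (poly q (s n)))"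
    using poly_trichotomy[OF p x(2)]
  proof (elim disjE)
    assume "\<forall>\<^sub>F n in sequentially. veq V (poly p (s n)) (poly q (s n))"
    then show ?thesis by (auto simp: veq_def elim: eventually_mono)
  next
    assume "\<forall>\<^sub>F n in sequentially. \<not> vdvd V (poly q (s n)) (poly p (s n))"
    then have "\<forall>\<^sub>F n in sequentially. vdvd V (poly p (s n)) (poly q (s n))"
      by (rule eventually_mono) (use vdvd_total in blast)
    then show ?thesis by blast
  next
    assume "\<forall>\<^sub>F n in sequentially. \<not> vdvd V (poly p (s n)) (poly q (s n))"
    then have "\<forall>\<^sub>F n in sequentially. vdvd V (poly q (s n)) (poly p (s n))"
      by (rule eventually_mono) (use vdvd_total in blast)
    then show ?thesis by blast
  qed
  then have "(\<forall>\<^sub>F n in sequentially. poly p (s n) / poly q (s n) \<in> V) \<or>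
    (\<forall>\<^sub>F n in sequentially. poly q (s n) / poly p (s n) \<in> V)"
  proof (elim disjE)
    assume "\<forall>\<^sub>F n in sequentially. vdvd V (poly q (s n)) (poly p (s n))"
    with poly_eventually_nonzero[OF x(2)]
    have "\<forall>\<^sub>F n in sequentially. poly p (s n) / poly q (s n) \<in> V"
      by eventually_elim (simp add: vdvd_iff_div)
    then show ?thesis by blast
  next
    assume "\<forall>\<^sub>F n in sequentially. vdvd V (poly p (s n)) (poly q (s n))"
    with poly_eventually_nonzero[OF p]
    have "\<forall>\<^sub>F n in sequentially. poly q (s n) / poly p (s n) \<in> V"
      by eventually_elim (simp add: vdvd_iff_div)
    then show ?thesis by blast
  qed
  then show "x \<in> eventually_in s V \<or> inverse x \<in> eventually_in s V"
    using x p by (simp add: Fract_mem_eventually_in)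
qed

text \<open>Through \<open>maximalideal_valuation_domain_iff\<close>, \<open>eventually_in s\<close>
  thus carries the maximal ideal of \<open>V\<close> to that of
  \<open>eventually_in s V\<close>.\<close>

lemma eventually_in_nonunits:
  "eventually_in s {x \<in> V. x = 0 \<or> inverse x \<notin> V} =
    {\<phi> \<in> eventually_in s V. \<phi> = 0 \<or> inverse \<phi> \<notin> eventually_in s V}"
proof (rule Set.set_eqI)
  fix x :: "'a poly fract"
  let ?M = "{x \<in> V. x = 0 \<or> inverse x \<notin> V}"
  obtain p q where x: "x = Fract p q" "q \<noteq> 0" by (cases x)
  show "x \<in> eventually_in s ?M \<longleftrightarrow>
    x \<in> {\<phi> \<in> eventually_in s V. \<phi> = 0 \<or> inverse \<phi> \<notin> eventually_in s V}"
  proof (cases "p = 0")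
    case True
    then have "x = 0" using x by (simp add: Zero_fract_def eq_fract)
    then show ?thesis
      using True x zero_closed by (simp add: Fract_mem_eventually_in Zero_fract_def)
  next
    case False
    then have "x \<noteq> 0" using x by (simp add: Zero_fract_def eq_fract)
    have nz: "\<forall>\<^sub>F n in sequentially. poly p (s n) \<noteq> 0 \<and> poly q (s n) \<noteq> 0"
      using poly_eventually_nonzero[OF False] poly_eventually_nonzero[OF x(2)]
      by (rule eventually_conj)
    let ?u = "\<lambda>n. vdvd V (poly q (s n)) (poly p (s n))"
    let ?w = "\<lambda>n. vdvd V (poly p (s n)) (poly q (s n))"
    have "x \<in> eventually_in s ?M \<longleftrightarrow> (\<forall>\<^sub>F n in sequentially. ?u n \<and> \<not> ?w n)"
      unfolding x(1) Fract_mem_eventually_in[OF x(2)]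
      by (rule eventually_subst, rule eventually_mono[OF nz]) (auto simp: vdvd_iff_div)
    moreover have "x \<in> eventually_in s V \<longleftrightarrow> (\<forall>\<^sub>F n in sequentially. ?u n)"
      unfolding x(1) Fract_mem_eventually_in[OF x(2)]
      by (rule eventually_subst, rule eventually_mono[OF nz]) (auto simp: vdvd_iff_div)
    moreover have "inverse x \<in> eventually_in s V \<longleftrightarrow> (\<forall>\<^sub>F n in sequentially. ?w n)"
      unfolding x(1) inverse_fract Fract_mem_eventually_in[OF False]
      by (rule eventually_subst, rule eventually_mono[OF nz]) (auto simp: vdvd_iff_div)
    moreover have "(\<forall>\<^sub>F n in sequentially. ?u n \<and> \<not> ?w n) \<longleftrightarrow>
      (\<forall>\<^sub>F n in sequentially. ?u n) \<and> \<not> (\<forall>\<^sub>F n in sequentially. ?w n)"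
    proof
      assume L: "\<forall>\<^sub>F n in sequentially. ?u n \<and> \<not> ?w n"
      have "\<not> (\<forall>\<^sub>F n in sequentially. ?w n)"
      proof
        assume "\<forall>\<^sub>F n in sequentially. ?w n"
        with L have "\<forall>\<^sub>F n in sequentially. False" by eventually_elim blast
        then show False by simp
      qed
      with L show "(\<forall>\<^sub>F n in sequentially. ?u n) \<and> \<not> (\<forall>\<^sub>F n in sequentially. ?w n)"
        by (simp add: eventually_conj_iff)
    next
      assume R: "(\<forall>\<^sub>F n in sequentially. ?u n) \<and> \<not> (\<forall>\<^sub>F n in sequentially. ?w n)"
      \<comment> \<open>The assumption only says that \<open>?w n\<close> fails infinitely often;
        the trichotomy upgrades this to failure for all but finitely many n.\<close>
      from poly_trichotomy[OF False x(2)]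
      show "\<forall>\<^sub>F n in sequentially. ?u n \<and> \<not> ?w n"
      proof (elim disjE)
        assume "\<forall>\<^sub>F n in sequentially. \<not> ?u n"
        then have "\<forall>\<^sub>F n in sequentially. ?w n"
          by (rule eventually_mono) (use vdvd_total in blast)
        then show ?thesis using R by blast
      next
        assume "\<forall>\<^sub>F n in sequentially. \<not> ?w n"
        then show ?thesis using R by (simp add: eventually_conj_iff)
      next
        assume "\<forall>\<^sub>F n in sequentially. veq V (poly p (s n)) (poly q (s n))"
        then have "\<forall>\<^sub>F n in sequentially. ?w n"
          by (rule eventually_mono) (simp add: veq_def)
        then show ?thesis using R by blast
      qed
    qed
    ultimately show ?thesis using \<open>x \<noteq> 0\<close> by simp
  qed
qed

text \<open>At s_m with m > n + 1, the quotient (X - s_n) / (X - s_(n+1)) has the value of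
  \<open>gap n / gap (n + 1)\<close>, which is negative; so it lies outside
  \<open>eventually_in s V\<close>.\<close>

lemma not_vdvd_X_minus:
  "\<not> vdvd (eventually_in s V) (rf_X - rf_const (s (n + 1))) (rf_X - rf_const (s n))"
proof
  assume d: "vdvd (eventually_in s V) (rf_X - rf_const (s (n + 1))) (rf_X - rf_const (s n))"
  interpret E: valuation_dom "eventually_in s V"
    by unfold_locales (rule valuation_domain_eventually_in)
  have X: "rf_X - rf_const c = Fract [:- c, 1:] 1" for c :: 'a
    by (simp add: rf_X_def rf_const_def to_fract_def)
  have "Fract [:- s (n + 1), 1:] 1 \<noteq> 0" by (simp add: Zero_fract_def eq_fract)
  with d have "Fract [:- s n, 1:] [:- s (n + 1), 1:] \<in> eventually_in s V"
    by (simp add: X E.vdvd_iff_div)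
  then have "\<forall>\<^sub>F m in sequentially. (s m - s n) / (s m - s (n + 1)) \<in> V"
    by (simp add: Fract_mem_eventually_in)
  moreover have "\<forall>\<^sub>F m in sequentially. (s m - s n) / (s m - s (n + 1)) \<notin> V"
    using eventually_gt_at_top[of "n + 1"]
  proof eventually_elim
    case (elim m)
    then have veq: "veq V (s m - s n) (gap n)" "veq V (s m - s (n + 1)) (gap (n + 1))"
      by (simp_all add: diff_veq_gap)
    then have "\<not> vdvd V (s m - s (n + 1)) (s m - s n)"
      using gap_less[of n "n + 1"] vdvd_cong by auto
    moreover have "s m - s (n + 1) \<noteq> 0" using veq_0_iff[OF veq(2)] gap_nz[of "n + 1"] by auto
    ultimately show ?case by (simp add: vdvd_iff_div)
  qed
  ultimately have "\<forall>\<^sub>F m in sequentially. False" by eventually_elim blast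
  then show False by simp
qed

end

theorem theorem3p8:
  fixes V M :: "'a::field set"
    and G :: "'g ordered_monoid" and v :: "'a \<Rightarrow> 'g option"
    and s :: "nat \<Rightarrow> 'a"
  assumes "valuation_domain V"
    and "maximalideal M (subring_of V)"
    and "valuation G v" and "valuation_ring G v = V"
    and "pseudo_convergent G v s"
  shows "valuation_domain (eventually_in s V)
    \<and> eventually_in s V \<inter> range rf_const = rf_const ` V
    \<and> (\<forall>N. maximalideal N (subring_of (eventually_in s V)) \<longleftrightarrow> N = eventually_in s M)
    \<and> pseudo_limit (value_group (eventually_in s V)) (assoc_valuation (eventually_in s V))
        (\<lambda>n. rf_const (s n)) rf_X"
proof -
  interpret pseudo_convergent_seq V s
    using assms(1,5) val_less_iff_not_vdvd[OF assms(3,4)]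
    by unfold_locales (auto simp: pseudo_convergent_def)
  note dom' = valuation_domain_eventually_in
  have "eventually_in s V \<inter> range rf_const = rf_const ` V"
    by (auto simp: rf_const_mem_eventually_in)
  moreover have "M = {x \<in> V. x = 0 \<or> inverse x \<notin> V}"
    using maximalideal_valuation_domain_iff[OF assms(1)] assms(2) by blast
  then have "maximalideal N (subring_of (eventually_in s V)) \<longleftrightarrow> N = eventually_in s M" for N
    by (simp only: maximalideal_valuation_domain_iff[OF dom'] eventually_in_nonunits)
  moreover have "pseudo_limit (value_group (eventually_in s V))
      (assoc_valuation (eventually_in s V)) (\<lambda>n. rf_const (s n)) rf_X"
    unfolding pseudo_limit_def
      val_less_iff_not_vdvd[OF valuation_assoc_valuation[OF dom']
        valuation_ring_assoc_valuation[OF dom']]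
    using not_vdvd_X_minus by blast
  ultimately show ?thesis using dom' by blast
qed

end
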